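(* Let $b\ge 2$ be an integer. For $N\in\mathbb{N}$ let \[ \nu_N=\frac{1}{N}\sum_{n=1}^{N}\delta_{\langle \log_b n\rangle}, \] a Borel probability measure on $[0,1[\subset X:=[0,1]$, and let $E_b\circ R^{-1}_{\langle -\log_b N\rangle}$ be the probability measure on $[0,1[$ with distribution function \[ t\mapsto \Big\langle \frac{b^{\langle t+y\rangle}-b^{y}}{b-1}\Big\rangle,\quad t\in[0,1[,\qquad y=\langle -\log_b N\rangle . \] Then \[ \lim_{N\to\infty}\frac{N}{\log N}\, d_X\big(\nu_N,\ E_b\circ R^{-1}_{\langle -\log_b N\rangle}\big)=\frac{1}{2\log b}. \]
   Context: $\langle a\rangle$ denotes the fractional part of $a\in\mathbb{R}$ and $\delta_a$ the Dirac measure at $a$. $E_b$ is the exponential distribution of parameter $\log b$ on $[0,1]$ with distribution function $F_{E_b}(t)=\frac{b^t-1}{b-1}$, and $E_b\circ R_y^{-1}$ is its push-forward under the rotation $R_y(t)=\langle t+y\rangle$ of $[0,1[$ (the distribution function displayed above). $X=[0,1]$ carries the metric $\rho_X(x,y)=|x-y|$, and for Borel probability measures $\mu,\nu$ on $X$ the Kantorovich distance is $d_X(\mu,\nu)=\inf_\gamma\int_{X\times X}|x-y|\,\gamma(dx,dy)$, the infimum over all Borel probability measures $\gamma$ on $X\times X$ with marginals $\mu$ and $\nu$. $\log$ is the natural logarithm. *)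

theory Defs
  imports "HOL-Probability.Probability"
begin

text \<open>Borel probability measures on the compact interval \<open>[0,1]\<close> are represented as
  \<open>real measure\<close>s whose underlying measurable space is \<open>unit_borel\<close>.\<close>

definition unit_borel :: "real measure" where
  "unit_borel = restrict_space borel {0..1}"

definition couplings :: "real measure \<Rightarrow> real measure \<Rightarrow> (real \<times> real) measure set" where
  "couplings \<mu> \<nu> = {\<gamma>. prob_space \<gamma> \<and> sets \<gamma> = sets (unit_borel \<Otimes>\<^sub>M unit_borel) \<and>
      distr \<gamma> unit_borel fst = \<mu> \<and> distr \<gamma> unit_borel snd = \<nu>}"

definition kantorovich :: "real measure \<Rightarrow> real measure \<Rightarrow> real" where
  "kantorovich \<mu> \<nu> = (INF \<gamma>\<in>couplings \<mu> \<nu>. \<integral>p. \<bar>fst p - snd p\<bar> \<partial>\<gamma>)"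

definition log_empirical :: "nat \<Rightarrow> nat \<Rightarrow> real measure" where
  "log_empirical b N =
     distr (uniform_count_measure {1..N}) unit_borel (\<lambda>n. frac (log (real b) (real n)))"

definition exp_dist :: "nat \<Rightarrow> real measure" where
  "exp_dist b = density (restrict_space lborel {0..1})
     (\<lambda>t. ennreal (ln (real b) * real b powr t / (real b - 1)))"

definition rotation :: "real \<Rightarrow> real \<Rightarrow> real" where
  "rotation y t = frac (t + y)"

text \<open>The measure with distribution function
  \<open>t \<mapsto> frac ((b powr frac (t + y) - b powr y) / (b - 1))\<close> on \<open>[0,1[\<close> is the image of
  \<open>exp_dist b\<close> under the map inverse to \<open>rotation y\<close>, i.e. under the rotation by \<open>-y\<close>; see
  \<open>measure_exp_dist_rotated\<close> and \<open>exp_dist_rotated_unique\<close> below.\<close>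

definition exp_dist_rotated :: "nat \<Rightarrow> real \<Rightarrow> real measure" where
  "exp_dist_rotated b y = distr (exp_dist b) unit_borel (rotation (- y))"

lemma space_unit_borel [simp]: "space unit_borel = {0..1}"
  by (simp add: unit_borel_def space_restrict_space)

lemma sets_unit_borel: "A \<in> sets unit_borel \<longleftrightarrow> A \<in> sets borel \<and> A \<subseteq> {0..1}"
  unfolding unit_borel_def by (subst sets_restrict_space_iff) auto

lemma pair_measure_in_couplings:
  assumes "prob_space \<mu>" "prob_space \<nu>" "sets \<mu> = sets unit_borel" "sets \<nu> = sets unit_borel"
  shows "\<mu> \<Otimes>\<^sub>M \<nu> \<in> couplings \<mu> \<nu>"
proof -
  interpret M: prob_space \<mu> by fact
  interpret N: prob_space \<nu> by fact
  interpret P: pair_prob_space \<mu> \<nu> ..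
  have s: "sets (\<mu> \<Otimes>\<^sub>M \<nu>) = sets (unit_borel \<Otimes>\<^sub>M unit_borel)"
    using assms by (intro sets_pair_measure_cong)
  have fst: "fst \<in> measurable (\<mu> \<Otimes>\<^sub>M \<nu>) unit_borel" and snd: "snd \<in> measurable (\<mu> \<Otimes>\<^sub>M \<nu>) unit_borel"
    using assms by (simp_all cong: measurable_cong_sets[OF s refl])
  have "distr (\<mu> \<Otimes>\<^sub>M \<nu>) unit_borel fst = \<mu>"
  proof (rule measure_eqI)
    fix A assume "A \<in> sets (distr (\<mu> \<Otimes>\<^sub>M \<nu>) unit_borel fst)"
    then have A: "A \<in> sets unit_borel" "A \<in> sets \<mu>" using assms by auto
    have "fst -` A \<inter> space (\<mu> \<Otimes>\<^sub>M \<nu>) = A \<times> space \<nu>"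
      using sets.sets_into_space[OF A(2)] by (auto simp: space_pair_measure)
    then show "emeasure (distr (\<mu> \<Otimes>\<^sub>M \<nu>) unit_borel fst) A = emeasure \<mu> A"
      using A by (simp add: emeasure_distr[OF fst] N.emeasure_pair_measure_Times N.emeasure_space_1)
  qed (use assms in simp)
  moreover have "distr (\<mu> \<Otimes>\<^sub>M \<nu>) unit_borel snd = \<nu>"
  proof (rule measure_eqI)
    fix A assume "A \<in> sets (distr (\<mu> \<Otimes>\<^sub>M \<nu>) unit_borel snd)"
    then have A: "A \<in> sets unit_borel" "A \<in> sets \<nu>" using assms by auto
    have "snd -` A \<inter> space (\<mu> \<Otimes>\<^sub>M \<nu>) = space \<mu> \<times> A"
      using sets.sets_into_space[OF A(2)] by (auto simp: space_pair_measure)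
    then show "emeasure (distr (\<mu> \<Otimes>\<^sub>M \<nu>) unit_borel snd) A = emeasure \<nu> A"
      using A by (simp add: emeasure_distr[OF snd] N.emeasure_pair_measure_Times M.emeasure_space_1)
  qed (use assms in simp)
  ultimately show ?thesis
    unfolding couplings_def using s P.prob_space_axioms by auto
qed

lemma frac_in_unit: "frac x \<in> {0..1::real}"
  using frac_ge_0[of x] frac_lt_1[of x] by auto

lemma emeasure_log_empirical:
  assumes "N \<ge> 1" "A \<in> sets unit_borel"
  shows "emeasure (log_empirical b N) A =
    ennreal (1 / real N) * (\<Sum>n = 1..N. emeasure (return unit_borel (frac (log (real b) (real n)))) A)"
proof -
  let ?f = "\<lambda>n::nat. frac (log (real b) (real n))"
  have m: "?f \<in> measurable (uniform_count_measure {1..N}) unit_borel"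
    unfolding measurable_def using frac_in_unit
    by (auto simp: space_uniform_count_measure sets_uniform_count_measure)
  have "emeasure (log_empirical b N) A = emeasure (uniform_count_measure {1..N}) (?f -` A \<inter> {1..N})"
    unfolding log_empirical_def using emeasure_distr[OF m assms(2)]
    by (simp add: space_uniform_count_measure)
  also have "\<dots> = ennreal (card (?f -` A \<inter> {1..N}) / N)"
    by (subst emeasure_uniform_count_measure) auto
  also have "\<dots> = ennreal (1 / real N) * ennreal (card (?f -` A \<inter> {1..N}))"
    by (subst ennreal_mult[symmetric]) auto
  also have "ennreal (card (?f -` A \<inter> {1..N})) = (\<Sum>n = 1..N. indicator A (?f n))"
  proof -
    have "(\<Sum>n = 1..N. indicator A (?f n) :: ennreal) = (\<Sum>n = 1..N. indicator (?f -` A) n)"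
      by (intro sum.cong) (auto simp: indicator_def)
    also have "\<dots> = of_nat (card ({1..N} \<inter> ?f -` A))"
      by (simp add: indicator_def sum.If_cases Int_def)
    finally show ?thesis by (simp add: Int_commute ennreal_of_nat_eq_real_of_nat)
  qed
  finally show ?thesis using assms(2) by simp
qed

lemma sets_exp_dist [simp]: "sets (exp_dist b) = sets unit_borel"
  by (simp add: exp_dist_def unit_borel_def cong: sets_restrict_space_cong)

lemma space_exp_dist [simp]: "space (exp_dist b) = {0..1}"
  by (simp add: exp_dist_def space_restrict_space)

lemma emeasure_exp_dist_Icc:
  assumes "b \<ge> 2" "0 \<le> s" "s \<le> t" "t \<le> 1"
  shows "emeasure (exp_dist b) {s..t} = ennreal ((real b powr t - real b powr s) / (real b - 1))"
proof -
  let ?g = "\<lambda>t. ln (real b) * real b powr t / (real b - 1)"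
  let ?G = "\<lambda>t. real b powr t / (real b - 1)"
  have b: "real b > 1" using assms by simp
  have "emeasure (exp_dist b) {s..t}
      = (\<integral>\<^sup>+x. ennreal (?g x) * indicator {s..t} x \<partial>restrict_space lborel {0..1})"
    unfolding exp_dist_def using assms
    by (subst emeasure_density) (auto simp: sets_restrict_space_iff intro!: measurable_restrict_space1)
  also have "\<dots> = (\<integral>\<^sup>+x. ennreal (?g x) * indicator {s..t} x * indicator {0..1} x \<partial>lborel)"
    by (subst nn_integral_restrict_space) auto
  also have "\<dots> = (\<integral>\<^sup>+x. ennreal (?g x) * indicator {s..t} x \<partial>lborel)"
    using assms by (intro nn_integral_cong) (auto simp: indicator_def)
  also have "\<dots> = ennreal (?G t - ?G s)"
  proof (rule nn_integral_FTC_Icc)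
    show "?g \<in> borel_measurable borel" by measurable
    fix x assume "x \<in> {s..t}"
    show "(?G has_real_derivative ?g x) (at x)"
      using b by (auto simp: powr_def intro!: derivative_eq_intros)
    show "0 \<le> ?g x" using b by simp
  qed (use assms in auto)
  finally show ?thesis by (simp add: diff_divide_distrib)
qed

lemma prob_space_exp_dist:
  assumes "b \<ge> 2" shows "prob_space (exp_dist b)"
proof
  show "emeasure (exp_dist b) (space (exp_dist b)) = 1"
    using emeasure_exp_dist_Icc[of b 0 1] assms by simp
qed

lemma measure_exp_dist_Icc:
  assumes "b \<ge> 2" "0 \<le> s" "s \<le> t" "t \<le> 1"
  shows "measure (exp_dist b) {s..t} = (real b powr t - real b powr s) / (real b - 1)"
  using emeasure_exp_dist_Icc[OF assms] assms
  by (simp add: measure_def divide_nonneg_nonneg)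

lemma measure_exp_dist:
  assumes "b \<ge> 2" "t \<in> {0..1}"
  shows "measure (exp_dist b) {0..t} = (real b powr t - 1) / (real b - 1)"
  using measure_exp_dist_Icc[of b 0 t] assms by simp

lemma measurable_rotation: "rotation y \<in> measurable (exp_dist b) unit_borel"
proof -
  have "rotation y \<in> measurable unit_borel unit_borel"
    unfolding unit_borel_def
  proof (rule measurable_restrict_space3)
    show "rotation y \<in> borel \<rightarrow>\<^sub>M borel" unfolding rotation_def frac_def by measurable
  qed (use frac_in_unit in \<open>auto simp: rotation_def\<close>)
  then show ?thesis by (simp cong: measurable_cong_sets)
qed

lemma prob_space_exp_dist_rotated:
  assumes "b \<ge> 2" shows "prob_space (exp_dist_rotated b y)"
  unfolding exp_dist_rotated_def
  by (rule prob_space.prob_space_distr[OF prob_space_exp_dist[OF assms] measurable_rotation])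

lemma sets_exp_dist_rotated [simp]: "sets (exp_dist_rotated b y) = sets unit_borel"
  by (simp add: exp_dist_rotated_def)

lemma measure_exp_dist_rotated:
  assumes b: "b \<ge> 2" and y: "y \<in> {0..<1}" and t: "t \<in> {0..<1}"
  shows "measure (exp_dist_rotated b y) {0..t} =
    frac ((real b powr frac (t + y) - real b powr y) / (real b - 1))"
proof -
  interpret E: prob_space "exp_dist b" using prob_space_exp_dist[OF b] .
  have b1: "real b > 1" using b by simp
  let ?P = "rotation (- y) -` {0..t} \<inter> {0..1}"
  have fr: "frac (x - y) = (if x < y then x - y + 1 else if x - y = 1 then 0 else x - y)"
    if "x \<in> {0..1}" for x
    using that y by (auto simp: frac_unique_iff)
  have fty: "frac (t + y) = (if t + y < 1 then t + y else t + y - 1)"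
    using y t by (auto simp: frac_unique_iff)
  have S: "{u..v} \<in> sets (exp_dist b)" if "0 \<le> u" "v \<le> 1" for u v
    using that by (auto simp: sets_unit_borel)
  have "measure (exp_dist_rotated b y) {0..t} = measure (exp_dist b) ?P"
    unfolding exp_dist_rotated_def using t measurable_rotation
    by (subst measure_distr) (auto simp: sets_unit_borel)
  also have "\<dots> = frac ((real b powr frac (t + y) - real b powr y) / (real b - 1))"
  proof (cases "t + y < 1")
    case True
    have P: "?P = {y..y+t} \<union> (if y = 0 then {1..1} else {})"
    proof (rule set_eqI)
      fix x show "x \<in> ?P \<longleftrightarrow> x \<in> {y..y+t} \<union> (if y = 0 then {1..1} else {})"
        using y t True fr[of x] by (cases "x \<in> {0..1}") (auto simp: rotation_def split: if_splits)
    qed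
    have "measure (exp_dist b) ?P = measure (exp_dist b) {y..y+t}"
    proof (cases "y = 0")
      case True
      then show ?thesis unfolding P using t b S[of 1 1] measure_exp_dist_Icc[of b 1 1]
        by (subst E.finite_measure_Union) (auto simp: sets_unit_borel)
    qed (simp add: P)
    also have "\<dots> = (real b powr (y + t) - real b powr y) / (real b - 1)"
      using y t True b by (intro measure_exp_dist_Icc) auto
    also have "\<dots> = frac \<dots>"
    proof -
      have "real b powr (y + t) < real b powr 1"
        using True b1 by (intro powr_less_mono) auto
      moreover have "real b powr y \<ge> 1" using b1 y by (intro ge_one_powr_ge_zero) auto
      moreover have "real b powr y \<le> real b powr (y + t)" using b1 t by (intro powr_mono) auto
      ultimately show ?thesis using b1 by (subst frac_eq[THEN iffD2]) (auto simp: field_simps)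
    qed
    finally show ?thesis using True by (simp add: fty add.commute)
  next
    case False
    have P: "?P = {0..y+t-1} \<union> {y..1}"
      using y t False by (auto simp: rotation_def fr split: if_splits)
    have "measure (exp_dist b) ?P = measure (exp_dist b) {0..y+t-1} + measure (exp_dist b) {y..1}"
      unfolding P using S[of 0 "y+t-1"] S[of y 1] y t by (intro E.finite_measure_Union) auto
    also have "\<dots> = (real b powr (y+t-1) - 1) / (real b - 1) + (real b - real b powr y) / (real b - 1)"
      using y t False b measure_exp_dist_Icc[of b 0 "y+t-1"] measure_exp_dist_Icc[of b y 1] by simp
    also have "\<dots> = (real b powr (y+t-1) - real b powr y) / (real b - 1) + 1"
    proof -
      have "(u - 1) / c + (c + 1 - v) / c = (u - v) / c + 1" if "c \<noteq> 0" for u v c :: real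
        using that by (simp add: field_simps)
      from this[of "real b - 1"] show ?thesis using b1 by simp
    qed
    also have "\<dots> = frac ((real b powr (y+t-1) - real b powr y) / (real b - 1))"
    proof -
      have 1: "real b powr (y+t-1) < real b powr y" using b1 t by (intro powr_less_mono) auto
      have 2: "real b powr y < real b powr 1" "real b powr (y+t-1) \<ge> 1"
        using False b1 y by (intro powr_less_mono ge_one_powr_ge_zero; simp)+
      let ?z = "(real b powr (y+t-1) - real b powr y) / (real b - 1)"
      have z: "-1 \<le> ?z" "?z < 0" using 1 2 b1 by (auto simp: field_simps)
      then have "\<lfloor>?z\<rfloor> = -1" by (intro floor_unique) auto
      then show ?thesis by (simp add: frac_def)
    qed
    finally show ?thesis using False by (simp add: fty add.commute)
  qed
  finally show ?thesis .
qed

lemma exp_dist_rotated_unique: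
  assumes b: "b \<ge> 2" and y: "y \<in> {0..<1}"
    and M: "prob_space M" "sets M = sets unit_borel"
    and cdf: "\<And>t. t \<in> {0..<1} \<Longrightarrow>
      measure M {0..t} = frac ((real b powr frac (t + y) - real b powr y) / (real b - 1))"
  shows "M = exp_dist_rotated b y"
proof -
  let ?R = "exp_dist_rotated b y"
  let ?L = "\<lambda>K. distr K borel (\<lambda>x::real. x)"
  have meas: "(\<lambda>x. x) \<in> measurable K borel" if "sets K = sets unit_borel" for K :: "real measure"
    using that by (simp add: unit_borel_def cong: measurable_cong_sets) (rule measurable_restrict_space1, simp)
  have dist: "real_distribution (?L K)" if "prob_space K" "sets K = sets unit_borel" for K
    using that meas[OF that(2)] by (simp add: prob_space.real_distribution_distr)
  have sp: "space K = {0..1}" if "sets K = sets unit_borel" for K :: "real measure"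
    using sets_eq_imp_space_eq[OF that] by simp
  have cdfL: "cdf (?L K) t = (if t < 0 then 0 else if t < 1 then measure K {0..t} else 1)"
    if K: "prob_space K" "sets K = sets unit_borel" for K t
  proof -
    have "cdf (?L K) t = measure K ({..t} \<inter> {0..1})"
      unfolding cdf_def using meas[OF K(2)] sp[OF K(2)] by (subst measure_distr) auto
    moreover have "{..t} \<inter> {0..1} = (if t < 0 then {} else if t < 1 then {0..t} else space K)"
      using sp[OF K(2)] by auto
    ultimately show ?thesis using prob_space.prob_space[OF K(1)] by (simp split: if_splits)
  qed
  have R: "prob_space ?R" "sets ?R = sets unit_borel"
    using prob_space_exp_dist_rotated[OF b] by auto
  have "cdf (?L M) = cdf (?L ?R)"
    using cdf measure_exp_dist_rotated[OF b y] by (auto simp: fun_eq_iff cdfL[OF M] cdfL[OF R])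
  then have eq: "?L M = ?L ?R" by (intro cdf_unique dist M R)
  show ?thesis
  proof (rule measure_eqI)
    fix A assume "A \<in> sets M"
    then have A: "A \<in> sets borel" "A \<subseteq> {0..1}" using M(2) by (auto simp: sets_unit_borel)
    have "emeasure (?L K) A = emeasure K A" if "sets K = sets unit_borel" for K
      using A meas[OF that] sp[OF that] by (subst emeasure_distr) (auto simp: Int_absorb2)
    then show "emeasure M A = emeasure ?R A" using eq M R by metis
  qed (use M in simp)
qed

end

theory Submission
  imports Defs
begin

text \<open>
  Let \<open>F\<close> and \<open>G\<close> be the distribution functions of the empirical measure and of the rotated
  exponential distribution. The latter is the law of the fractional part of \<open>log b X\<close> for \<open>X\<close>
  uniform on \<open>{0<..N}\<close>. Comparing the number of integers with the length of the intervals
  \<open>{b ^ k..b powr (k + t)}\<close> for \<open>k \<ge> 0\<close>, and losing at most 1 to all negative \<open>k\<close>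
  together, gives \<open>G \<le> F + 1 / N\<close>. Since the measures are almost stochastically ordered, their
  Kantorovich distance differs from the difference of their means by at most \<open>2 / N\<close>. Both means
  are explicit, and by Stirling's formula \<open>N\<close> times their difference is
  \<open>ln N / (2 * ln b) + O(1)\<close>.
\<close>

section \<open>The Kantorovich distance and the difference of means\<close>

lemma borel_measurable_unit_ident: "(\<lambda>x. x) \<in> borel_measurable unit_borel"
  unfolding unit_borel_def by (rule measurable_restrict_space1) simp

text \<open>The integral of \<open>snd p - fst p\<close> depends only on the marginals, so every
  coupling costs at least the difference of means. This is the easy half of Kantorovich duality,
  tested with the identity as 1-Lipschitz function.\<close>

lemma kantorovich_ge_mean_diff:
  assumes "prob_space \<mu>" "prob_space \<nu>" "sets \<mu> = sets unit_borel" "sets \<nu> = sets unit_borel"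
  shows "(\<integral>x. x \<partial>\<nu>) - (\<integral>x. x \<partial>\<mu>) \<le> kantorovich \<mu> \<nu>"
  unfolding kantorovich_def
proof (rule cINF_greatest)
  \<comment> \<open>A real infimum over the empty set would be unspecified; the product measure is a
    coupling.\<close>
  show "couplings \<mu> \<nu> \<noteq> {}"
    using pair_measure_in_couplings[OF assms] by blast
  fix \<gamma> assume "\<gamma> \<in> couplings \<mu> \<nu>"
  then have \<gamma>: "prob_space \<gamma>" and s: "sets \<gamma> = sets (unit_borel \<Otimes>\<^sub>M unit_borel)"
    and d: "distr \<gamma> unit_borel fst = \<mu>" "distr \<gamma> unit_borel snd = \<nu>"
    by (auto simp: couplings_def)
  interpret prob_space \<gamma> by fact
  have m[measurable]: "fst \<in> measurable \<gamma> unit_borel" "snd \<in> measurable \<gamma> unit_borel"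
    by (simp_all cong: measurable_cong_sets[OF s refl])
  have mb[measurable]: "fst \<in> borel_measurable \<gamma>" "snd \<in> borel_measurable \<gamma>"
    using measurable_compose[OF m(1) borel_measurable_unit_ident]
      measurable_compose[OF m(2) borel_measurable_unit_ident] by auto
  have sp: "space \<gamma> = {0..1} \<times> {0..1}"
    using sets_eq_imp_space_eq[OF s] by (simp add: space_pair_measure)
  have int: "integrable \<gamma> fst" "integrable \<gamma> snd"
    by (rule integrable_const_bound[where B = 1]; auto simp: sp)+
  have "(\<integral>x. x \<partial>\<nu>) = (\<integral>p. snd p \<partial>\<gamma>)" "(\<integral>x. x \<partial>\<mu>) = (\<integral>p. fst p \<partial>\<gamma>)"
    unfolding d[symmetric] by (simp_all add: integral_distr[OF _ borel_measurable_unit_ident])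
  then have "(\<integral>x. x \<partial>\<nu>) - (\<integral>x. x \<partial>\<mu>) = (\<integral>p. snd p - fst p \<partial>\<gamma>)"
    using int by simp
  also have "\<dots> \<le> (\<integral>p. \<bar>fst p - snd p\<bar> \<partial>\<gamma>)"
    using int by (intro integral_mono) auto
  finally show "(\<integral>x. x \<partial>\<nu>) - (\<integral>x. x \<partial>\<mu>) \<le> (\<integral>p. \<bar>fst p - snd p\<bar> \<partial>\<gamma>)" .
qed

lemma kantorovich_le_coupling:
  assumes "\<gamma> \<in> couplings \<mu> \<nu>"
  shows "kantorovich \<mu> \<nu> \<le> (\<integral>p. \<bar>fst p - snd p\<bar> \<partial>\<gamma>)"
  unfolding kantorovich_def using assms by (intro cINF_lower bdd_belowI2[where m = 0]) auto

section \<open>Quantile functions and the monotone coupling\<close>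

text \<open>The interval is open because the generalised inverse of a distribution function may be
  infinite at 0 and 1.\<close>

abbreviation unit_lebesgue :: "real measure" where
  "unit_lebesgue \<equiv> restrict_space lborel {0<..<1}"

lemma prob_space_unit_lebesgue: "prob_space unit_lebesgue"
  by (auto simp: space_restrict_space emeasure_restrict_space intro!: prob_spaceI)

text \<open>\<open>q\<close> is the generalised inverse of the distribution function, with law \<mu>
  under the uniform distribution. It is built for the image of \<mu> on the whole line and then
  brought back to \<open>unit_borel\<close>.\<close>

lemma quantile_function:
  assumes \<mu>: "prob_space \<mu>" "sets \<mu> = sets unit_borel"
  obtains q where "q \<in> measurable unit_lebesgue unit_borel" "distr unit_lebesgue unit_borel q = \<mu>"
    "\<And>u t. u \<in> {0<..<1} \<Longrightarrow> t \<in> {0..1} \<Longrightarrow> q u \<le> t \<longleftrightarrow> u \<le> measure \<mu> {0..t}"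
proof -
  let ?M = "distr \<mu> borel (\<lambda>x::real. x)"
  have meas: "(\<lambda>x. x) \<in> measurable \<mu> borel"
    using borel_measurable_unit_ident by (simp cong: measurable_cong_sets[OF \<mu>(2) refl])
  have sp: "space \<mu> = {0..1}" using sets_eq_imp_space_eq[OF \<mu>(2)] by simp
  interpret M: cdf_distribution ?M
    unfolding cdf_distribution_def using \<mu>(1) meas by (simp add: prob_space.real_distribution_distr)
  have cdf: "cdf ?M t = measure \<mu> ({..t} \<inter> {0..1})" for t
    unfolding cdf_def using meas sp by (subst measure_distr) auto
  have cdf_unit: "cdf ?M t = measure \<mu> {0..t}" if "t \<in> {0..1}" for t
  proof -
    have "{..t} \<inter> {0..1} = {0..t}" using that by auto
    then show ?thesis by (simp only: cdf measure_empty)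
  qed
  have cdf_neg: "cdf ?M t = 0" if "t < 0" for t
  proof -
    have "{..t} \<inter> {0..1} = {}" using that by auto
    then show ?thesis by (simp only: cdf measure_empty)
  qed
  have cdf_1: "cdf ?M 1 = 1"
    using cdf_unit[of 1] prob_space.prob_space[OF \<mu>(1)] sp by simp
  define q where "q = M.I"
  have q_iff: "u \<le> cdf ?M t \<longleftrightarrow> q u \<le> t" if "u \<in> {0<..<1}" for u t
    using M.pseudoinverse[of u t] that by (simp add: q_def)
  have q_unit: "q u \<in> {0..1}" if u: "u \<in> {0<..<1}" for u
  proof -
    \<comment> \<open>The equivalence is used at \<open>t = 1\<close>, where the distribution
      function is 1, and at \<open>t = q u\<close>, where it would be 0 if \<open>q u\<close> were
      negative, contradicting \<open>u > 0\<close>.\<close>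
    have "q u \<le> 1" using q_iff[OF u, of 1] cdf_1 u by simp
    moreover have "\<not> q u < 0" using q_iff[OF u, of "q u"] cdf_neg[of "q u"] u by auto
    ultimately show ?thesis by simp
  qed
  have q_borel: "q \<in> borel_measurable unit_lebesgue"
    unfolding q_def using M.measurable_CI
    by (simp cong: measurable_cong_sets add: sets_restrict_space)
  have q_meas: "q \<in> measurable unit_lebesgue unit_borel"
    unfolding unit_borel_def by (rule measurable_restrict_space2[OF _ q_borel])
      (use q_unit in \<open>auto simp: space_restrict_space\<close>)
  have "distr unit_lebesgue unit_borel q = \<mu>"
  proof (rule measure_eqI)
    fix A assume "A \<in> sets (distr unit_lebesgue unit_borel q)"
    then have A: "A \<in> sets unit_borel" "A \<in> sets borel" "A \<subseteq> {0..1}" by (auto simp: sets_unit_borel)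
    have "emeasure (distr unit_lebesgue unit_borel q) A = emeasure (distr unit_lebesgue borel q) A"
      using A by (simp add: emeasure_distr[OF q_meas] emeasure_distr[OF q_borel])
    also have "\<dots> = emeasure ?M A" unfolding q_def by (simp add: M.distr_I_eq_M)
    also have "\<dots> = emeasure \<mu> A"
      using A meas sp by (subst emeasure_distr) (auto simp: Int_absorb2)
    finally show "emeasure (distr unit_lebesgue unit_borel q) A = emeasure \<mu> A" .
  qed (use \<mu> in simp)
  with q_meas show ?thesis
    by (rule that) (simp add: q_iff[symmetric] cdf_unit)
qed

text \<open>Both quantile functions are driven by the same uniform \<open>u\<close>. Since
  \<open>\<bar>x - y\<bar> = (y - x) + 2 * max 0 (x - y)\<close>, the cost of this coupling exceeds
  the difference of means by twice the mean violation of the order \<open>p \<le> q\<close>, and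
  that mean is at most \<open>c\<close>.\<close>

lemma kantorovich_le_mean_diff:
  assumes \<mu>: "prob_space \<mu>" "sets \<mu> = sets unit_borel"
    and \<nu>: "prob_space \<nu>" "sets \<nu> = sets unit_borel"
    and c: "c \<ge> 0" "\<And>t. t \<in> {0..<1} \<Longrightarrow> measure \<nu> {0..t} \<le> measure \<mu> {0..t} + c"
  shows "kantorovich \<mu> \<nu> \<le> (\<integral>x. x \<partial>\<nu>) - (\<integral>x. x \<partial>\<mu>) + 2 * c"
proof -
  let ?\<Omega> = unit_lebesgue
  interpret \<Omega>: prob_space ?\<Omega> by (rule prob_space_unit_lebesgue)
  interpret P: pair_sigma_finite ?\<Omega> "lborel :: real measure" ..
  have sp\<Omega>: "space ?\<Omega> = {0<..<1}" by (simp add: space_restrict_space)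
  obtain p where p[measurable]: "p \<in> measurable ?\<Omega> unit_borel"
    and dp: "distr ?\<Omega> unit_borel p = \<mu>"
    and p_iff: "\<And>u t. u \<in> {0<..<1} \<Longrightarrow> t \<in> {0..1} \<Longrightarrow> p u \<le> t \<longleftrightarrow> u \<le> measure \<mu> {0..t}"
    using quantile_function[OF \<mu>] by metis
  obtain q where q[measurable]: "q \<in> measurable ?\<Omega> unit_borel"
    and dq: "distr ?\<Omega> unit_borel q = \<nu>"
    and q_iff: "\<And>u t. u \<in> {0<..<1} \<Longrightarrow> t \<in> {0..1} \<Longrightarrow> q u \<le> t \<longleftrightarrow> u \<le> measure \<nu> {0..t}"
    using quantile_function[OF \<nu>] by metis
  have pb[measurable]: "p \<in> borel_measurable ?\<Omega>" and qb[measurable]: "q \<in> borel_measurable ?\<Omega>"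
    using measurable_compose[OF p borel_measurable_unit_ident]
      measurable_compose[OF q borel_measurable_unit_ident] by auto
  have p01: "p u \<in> {0..1}" and q01: "q u \<in> {0..1}" if "u \<in> {0<..<1}" for u
    using measurable_space[OF p] measurable_space[OF q] that sp\<Omega> by auto
  have int: "integrable ?\<Omega> p" "integrable ?\<Omega> q" "integrable ?\<Omega> (\<lambda>u. max 0 (p u - q u))"
    using p01 q01 by (intro \<Omega>.integrable_const_bound[where B = 1];
      force intro!: AE_I2 simp: sp\<Omega>)+
  have pq: "(\<lambda>u. (p u, q u)) \<in> measurable ?\<Omega> (unit_borel \<Otimes>\<^sub>M unit_borel)" by measurable
  let ?\<gamma> = "distr ?\<Omega> (unit_borel \<Otimes>\<^sub>M unit_borel) (\<lambda>u. (p u, q u))"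
  have "?\<gamma> \<in> couplings \<mu> \<nu>"
    unfolding couplings_def using \<Omega>.prob_space_distr[OF pq] dp dq
    by (auto simp: distr_distr[OF _ pq] comp_def)
  then have "kantorovich \<mu> \<nu> \<le> (\<integral>z. \<bar>fst z - snd z\<bar> \<partial>?\<gamma>)"
    by (rule kantorovich_le_coupling)
  also have "\<dots> = (\<integral>u. \<bar>p u - q u\<bar> \<partial>?\<Omega>)"
  proof -
    have [measurable]: "(fst :: real \<times> real \<Rightarrow> real) \<in> borel_measurable (unit_borel \<Otimes>\<^sub>M unit_borel)"
      "(snd :: real \<times> real \<Rightarrow> real) \<in> borel_measurable (unit_borel \<Otimes>\<^sub>M unit_borel)"
      using measurable_compose[OF measurable_fst borel_measurable_unit_ident]
        measurable_compose[OF measurable_snd borel_measurable_unit_ident] by auto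
    show ?thesis by (subst integral_distr[OF pq]) auto
  qed
  also have "\<dots> = (\<integral>u. q u - p u + 2 * max 0 (p u - q u) \<partial>?\<Omega>)"
    by (intro Bochner_Integration.integral_cong) (auto simp: max_def)
  also have "\<dots> = (\<integral>u. q u \<partial>?\<Omega>) - (\<integral>u. p u \<partial>?\<Omega>) + 2 * (\<integral>u. max 0 (p u - q u) \<partial>?\<Omega>)"
    using int by simp
  also have "(\<integral>u. q u \<partial>?\<Omega>) = (\<integral>x. x \<partial>\<nu>)"
    unfolding dq[symmetric] by (simp add: integral_distr[OF q borel_measurable_unit_ident])
  also have "(\<integral>u. p u \<partial>?\<Omega>) = (\<integral>x. x \<partial>\<mu>)"
    unfolding dp[symmetric] by (simp add: integral_distr[OF p borel_measurable_unit_ident])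
  also have "(\<integral>u. max 0 (p u - q u) \<partial>?\<Omega>) \<le> c"
    \<comment> \<open>\<open>max 0 (p u - q u)\<close> is the length of \<open>{q u..<p u}\<close>; after Fubini, the \<open>u\<close> with \<open>t\<close> in that
      interval are those between the two distribution functions at \<open>t\<close>.\<close>
  proof -
    let ?S = "{z \<in> space (?\<Omega> \<Otimes>\<^sub>M lborel). q (fst z) \<le> snd z \<and> snd z < p (fst z)}"
    have S[measurable]: "?S \<in> sets (?\<Omega> \<Otimes>\<^sub>M lborel)" by measurable
    have "ennreal (\<integral>u. max 0 (p u - q u) \<partial>?\<Omega>) = (\<integral>\<^sup>+u. ennreal (max 0 (p u - q u)) \<partial>?\<Omega>)"
      using int(3) by (intro nn_integral_eq_integral[symmetric]) auto
    also have "\<dots> = (\<integral>\<^sup>+u. (\<integral>\<^sup>+t. indicator ?S (u, t) \<partial>lborel) \<partial>?\<Omega>)"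
    proof (rule nn_integral_cong)
      fix u assume u: "u \<in> space ?\<Omega>"
      have "(\<integral>\<^sup>+t. indicator ?S (u, t) \<partial>lborel) = (\<integral>\<^sup>+t. indicator {q u..<p u} t \<partial>lborel)"
        using u by (intro nn_integral_cong) (auto simp: indicator_def space_pair_measure)
      then show "ennreal (max 0 (p u - q u)) = (\<integral>\<^sup>+t. indicator ?S (u, t) \<partial>lborel)"
        by (cases "q u \<le> p u") (auto simp: max_def)
    qed
    also have "\<dots> = (\<integral>\<^sup>+t. (\<integral>\<^sup>+u. indicator ?S (u, t) \<partial>?\<Omega>) \<partial>lborel)"
      by (rule P.Fubini'[symmetric]) (simp add: case_prod_beta')
    also have "\<dots> \<le> (\<integral>\<^sup>+(t::real). ennreal c * indicator {0..<1} t \<partial>lborel)"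
    proof (rule nn_integral_mono)
      fix t :: real
      show "(\<integral>\<^sup>+u. indicator ?S (u, t) \<partial>?\<Omega>) \<le> ennreal c * indicator {0..<1} t"
      proof (cases "t \<in> {0..<1}")
        case True
        let ?F = "measure \<mu> {0..t}" and ?G = "measure \<nu> {0..t}"
        have "(\<integral>\<^sup>+u. indicator ?S (u, t) \<partial>?\<Omega>)
            = (\<integral>\<^sup>+u. indicator ?S (u, t) * indicator {0<..<1} u \<partial>lborel)"
          by (subst nn_integral_restrict_space) auto
        also have "\<dots> \<le> (\<integral>\<^sup>+u. indicator {?F<..?G} u \<partial>lborel)"
        proof (intro nn_integral_mono)
          fix u :: real
          show "(indicator ?S (u, t) * indicator {0<..<1} u :: ennreal) \<le> indicator {?F<..?G} u"
            using True p_iff[of u t] q_iff[of u t]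
            by (auto simp: indicator_def not_le[symmetric] split: if_splits)
        qed
        also have "\<dots> \<le> ennreal c"
          using c(2)[OF True] c(1) by (cases "?F \<le> ?G") (auto intro!: ennreal_leI)
        finally show ?thesis using True by simp
      next
        case False
        \<comment> \<open>Both quantiles lie in \<open>{0..1}\<close>, so \<open>q u \<le> t\<close>
          and \<open>t < p u\<close> force \<open>t\<close> into \<open>{0..<1}\<close>, the range
          covered by \<open>c(2)\<close>.\<close>
        have "indicator ?S (u, t) = (0::ennreal)" if "u \<in> space ?\<Omega>" for u
          using False p01[of u] q01[of u] that by (auto simp: indicator_def sp\<Omega>)
        then have "(\<integral>\<^sup>+u. indicator ?S (u, t) \<partial>?\<Omega>) = (\<integral>\<^sup>+u. 0 \<partial>?\<Omega>)"
          by (intro nn_integral_cong) auto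
        then show ?thesis by simp
      qed
    qed
    also have "\<dots> = ennreal c" by (subst nn_integral_cmult_indicator) auto
    finally show ?thesis using c(1) by (simp add: ennreal_le_iff)
  qed
  finally show ?thesis by simp
qed

section \<open>Means of the two measures\<close>

lemma measurable_frac_log:
  "(\<lambda>n. frac (log (real b) (real n))) \<in> measurable (uniform_count_measure A) unit_borel"
  unfolding measurable_def using frac_in_unit
  by (auto simp: space_uniform_count_measure sets_uniform_count_measure)

lemma integral_log_empirical:
  "(\<integral>x. x \<partial>log_empirical b N) = (\<Sum>n = 1..N. frac (log (real b) (real n))) / real N"
  unfolding log_empirical_def
  by (subst integral_distr[OF measurable_frac_log borel_measurable_unit_ident])
    (simp add: integral_uniform_count_measure)

lemma measure_log_empirical:
  assumes "A \<in> sets unit_borel"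
  shows "measure (log_empirical b N) A = real (card {n \<in> {1..N}. frac (log (real b) (real n)) \<in> A}) / real N"
proof -
  have "(\<lambda>n::nat. frac (log (real b) (real n))) -` A \<inter> {1..N} = {n \<in> {1..N}. frac (log (real b) (real n)) \<in> A}"
    by auto
  moreover have "measure (uniform_count_measure {1..N}) X = real (card X) / real N" if "X \<subseteq> {1..N}" for X
    using that by (subst measure_uniform_count_measure) auto
  moreover have "{n \<in> {1..N}. frac (log (real b) (real n)) \<in> A} \<subseteq> {1..N}" by auto
  ultimately show ?thesis
    unfolding log_empirical_def
    by (simp only: measure_distr[OF measurable_frac_log assms] space_uniform_count_measure)
qed

lemma prob_space_log_empirical:
  assumes "N \<ge> 1"
  shows "prob_space (log_empirical b N)"
  unfolding log_empirical_def
proof (rule prob_space.prob_space_distr)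
  show "prob_space (uniform_count_measure {1..N})"
    using assms by (intro prob_space_uniform_count_measure) auto
qed (rule measurable_frac_log)

lemma sets_log_empirical [simp]: "sets (log_empirical b N) = sets unit_borel"
  by (simp add: log_empirical_def)

section \<open>Sums of floors and fractional parts of logarithms\<close>

lemma power_le_iff_le_floor_log:
  assumes "b > 1" "n > 0"
  shows "b ^ k \<le> n \<longleftrightarrow> int k \<le> \<lfloor>log (real b) (real n)\<rfloor>"
proof -
  have "int k \<le> \<lfloor>log (real b) (real n)\<rfloor> \<longleftrightarrow> real b powr real k \<le> real n"
    using assms by (simp add: le_floor_iff le_log_iff)
  also have "\<dots> \<longleftrightarrow> real (b ^ k) \<le> real n"
    using assms by (simp add: powr_realpow)
  finally show ?thesis by (simp only: of_nat_le_iff)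
qed

lemma sum_power_mult_pred:
  fixes b :: "'a::comm_ring_1"
  assumes "m \<le> n"
  shows "(\<Sum>k = m..<n. b ^ k) * (b - 1) = b ^ n - b ^ m"
  using assms by (induction n rule: dec_induct) (auto simp: algebra_simps)

text \<open>Double counting: the floor is the number of \<open>k\<close> in \<open>{1..m}\<close>
  with \<open>b ^ k \<le> n\<close>. After exchanging the sums, each \<open>k\<close> contributes
  the \<open>N + 1 - b ^ k\<close> integers from \<open>b ^ k\<close> to \<open>N\<close>, which
  leaves a geometric sum.\<close>

lemma sum_floor_log:
  fixes b N m :: nat
  assumes b: "b \<ge> 2" and m: "b ^ m \<le> N" "N < b ^ Suc m"
  shows "(\<Sum>n = 1..N. real_of_int \<lfloor>log (real b) (real n)\<rfloor>) =
    real m * real N + real m - (real b ^ Suc m - real b) / (real b - 1)"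
proof -
  have floor: "real_of_int \<lfloor>log (real b) (real n)\<rfloor> = (\<Sum>k = 1..m. if b ^ k \<le> n then 1 else 0)"
    if n: "n \<in> {1..N}" for n
  proof -
    let ?j = "\<lfloor>log (real b) (real n)\<rfloor>"
    have iff: "b ^ k \<le> n \<longleftrightarrow> int k \<le> ?j" for k
      using b n by (intro power_le_iff_le_floor_log) auto
    \<comment> \<open>Since \<open>n \<le> N\<close>, the floor never exceeds \<open>m\<close>, so
      stopping the count at \<open>k = m\<close> loses nothing.\<close>
    have "\<not> b ^ Suc m \<le> n" using m n by simp
    then have "?j \<le> int m" using iff[of "Suc m"] by simp
    moreover have "0 \<le> ?j" using iff[of 0] n by simp
    ultimately have "{1..m} \<inter> {k. b ^ k \<le> n} = {1..nat ?j}"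
      by (auto simp: iff)
    then show ?thesis using \<open>0 \<le> ?j\<close> by (simp add: sum.If_cases)
  qed
  have "(\<Sum>n = 1..N. real_of_int \<lfloor>log (real b) (real n)\<rfloor>)
      = (\<Sum>k = 1..m. \<Sum>n = 1..N. if b ^ k \<le> n then 1 else 0)"
    by (simp only: floor cong: sum.cong) (rule sum.swap)
  also have "\<dots> = (\<Sum>k = 1..m. real N + 1 - real b ^ k)"
  proof (rule sum.cong)
    fix k assume k: "k \<in> {1..m}"
    have "b ^ k \<le> b ^ m" using k b by (intro power_increasing) auto
    then have "b ^ k \<le> N" using m by simp
    moreover have "1 \<le> b ^ k" using b by simp
    then have "{1..N} \<inter> {n. b ^ k \<le> n} = {b ^ k..N}"
      by auto
    ultimately show "(\<Sum>n = 1..N. if b ^ k \<le> n then 1 else 0) = real N + 1 - real b ^ k"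
      by (simp add: sum.If_cases of_nat_diff)
  qed simp
  also have "\<dots> = real m * real N + real m - (\<Sum>k = 1..<Suc m. real b ^ k)"
    by (simp add: sum_subtractf algebra_simps atLeastLessThanSuc_atLeastAtMost)
  also have "(\<Sum>k = 1..<Suc m. real b ^ k) = (real b ^ Suc m - real b) / (real b - 1)"
    using sum_power_mult_pred[of 1 "Suc m" "real b"] b by (simp add: field_simps)
  finally show ?thesis .
qed

text \<open>The logarithms add up to \<open>ln (fact N) / ln (real b)\<close>, which brings in
  Stirling's formula; the floors are subtracted exactly.\<close>

lemma sum_frac_log:
  fixes b N m :: nat
  assumes b: "b \<ge> 2" and m: "b ^ m \<le> N" "N < b ^ Suc m"
  shows "(\<Sum>n = 1..N. frac (log (real b) (real n))) =
    ln (fact N) / ln (real b) - real m * real N - real m + (real b ^ Suc m - real b) / (real b - 1)"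
proof -
  have "ln (fact N) = (\<Sum>n = 1..N. ln (real n))"
    by (induction N) (auto simp: ln_mult)
  then have "(\<Sum>n = 1..N. log (real b) (real n)) = ln (fact N) / ln (real b)"
    by (simp add: log_def sum_divide_distrib)
  then show ?thesis
    using sum_floor_log[OF assms] by (simp add: frac_def sum_subtractf)
qed

section \<open>Means of the exponential distribution and of its rotations\<close>

lemma integral_exp_dist:
  assumes b: "b \<ge> 2"
  shows "(\<integral>x. x \<partial>exp_dist b) = real b / (real b - 1) - 1 / ln (real b)"
proof -
  let ?g = "\<lambda>t. ln (real b) * real b powr t / (real b - 1)"
  \<comment> \<open>Antiderivative of \<open>?g t * t\<close>, found by integration by
    parts.\<close>
  let ?G = "\<lambda>t. (t - 1 / ln (real b)) * real b powr t / (real b - 1)"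
  have b1: "real b > 1" using b by simp
  have "(\<integral>x. x \<partial>exp_dist b) = (\<integral>x. ?g x * x \<partial>restrict_space lborel {0..1})"
    unfolding exp_dist_def using b1
    by (subst integral_density) (auto intro!: measurable_restrict_space1)
  also have "\<dots> = (\<integral>x. (?g x * x) * indicator {0..1} x \<partial>lborel)"
    by (subst integral_restrict_space) (auto simp: mult.commute)
  also have "\<dots> = ?G 1 - ?G 0"
  proof (rule integral_FTC_Icc_real)
    fix x :: real
    have "(?G has_real_derivative
        (real b powr x + (x - 1 / ln (real b)) * (ln (real b) * real b powr x)) / (real b - 1)) (at x)"
      using b1 by (auto simp: powr_def intro!: derivative_eq_intros)
    also have "real b powr x + (x - 1 / ln (real b)) * (ln (real b) * real b powr x)
        = ln (real b) * real b powr x * x"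
      using b1 by (simp add: field_simps)
    finally show "(?G has_real_derivative ?g x * x) (at x)" by simp
    show "isCont (\<lambda>x. ?g x * x) x"
      using b1 by (auto intro!: continuous_intros)
  qed simp
  also have "\<dots> = real b / (real b - 1) - 1 / ln (real b)"
    using b1 by (simp add: field_simps)
  finally show ?thesis .
qed

text \<open>Up to null sets, rotation by \<open>- y\<close> subtracts \<open>y\<close> everywhere
  and adds 1 on \<open>{0..y}\<close>. The mean therefore changes by \<open>- y\<close> plus the
  mass of that interval.\<close>

lemma integral_exp_dist_rotated:
  assumes b: "b \<ge> 2" and y: "y \<in> {0..<1}"
  shows "(\<integral>x. x \<partial>exp_dist_rotated b y) =
    real b / (real b - 1) - 1 / ln (real b) - y + (real b powr y - 1) / (real b - 1)"
proof -
  interpret E: prob_space "exp_dist b" by (rule prob_space_exp_dist[OF b])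
  have id[measurable]: "(\<lambda>x. x) \<in> borel_measurable (exp_dist b)"
    using borel_measurable_unit_ident by (simp cong: measurable_cong_sets)
  have rot[measurable]: "rotation (- y) \<in> borel_measurable (exp_dist b)"
    using measurable_compose[OF measurable_rotation borel_measurable_unit_ident] .
  have int: "integrable (exp_dist b) (\<lambda>x. x)"
    by (rule E.integrable_const_bound[where B = 1]) auto
  have S: "{0..y} \<in> sets (exp_dist b)" using y by (auto simp: sets_unit_borel)
  have null: "AE x in exp_dist b. x \<noteq> a" if "a \<in> {0..1}" for a
    by (rule AE_I'[of "{a}"])
      (use that emeasure_exp_dist_Icc[OF b, of a a] in \<open>auto intro!: null_setsI simp: sets_unit_borel\<close>)
  have "(\<integral>x. x \<partial>exp_dist_rotated b y) = (\<integral>x. rotation (- y) x \<partial>exp_dist b)"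
    unfolding exp_dist_rotated_def by (rule integral_distr[OF measurable_rotation borel_measurable_unit_ident])
  also have "\<dots> = (\<integral>x. x - y + indicator {0..y} x \<partial>exp_dist b)"
  proof (rule integral_cong_AE)
    \<comment> \<open>At \<open>x = y\<close> the indicator adds a spurious 1, and at
      \<open>x = 1\<close> the formula fails when \<open>y = 0\<close>; single points have mass
      0.\<close>
    have "AE x in exp_dist b. x \<noteq> y" "AE x in exp_dist b. x \<noteq> 1" "AE x in exp_dist b. x \<in> space (exp_dist b)"
      using null[of y] null[of 1] y by auto
    then show "AE x in exp_dist b. rotation (- y) x = x - y + indicator {0..y} x"
    proof eventually_elim
      case (elim x)
      then show ?case
        using y by (cases "x < y") (auto simp: rotation_def frac_unique_iff indicator_def)
    qed
  qed (use S in \<open>auto\<close>)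
  also have "\<dots> = (\<integral>x. x \<partial>exp_dist b) - y + measure (exp_dist b) {0..y}"
    using int S E.prob_space y by (simp add: E.emeasure_eq_measure)
  also have "\<dots> = real b / (real b - 1) - 1 / ln (real b) - y + (real b powr y - 1) / (real b - 1)"
    using integral_exp_dist[OF b] measure_exp_dist[OF b, of y] y by simp
  finally show ?thesis .
qed

text \<open>Powers of \<open>b\<close> are set apart because \<open>- log (real b) (real N)\<close>
  is then an integer with fractional part 0, while the formula
  \<open>real m + 1 - log (real b) (real N)\<close> of the other case would give 1.\<close>

lemma frac_neg_log_cases:
  fixes b N m :: nat
  assumes b: "b \<ge> 2" and m: "b ^ m \<le> N" "N < b ^ Suc m"
  obtains "N = b ^ m" "frac (- log (real b) (real N)) = 0" "log (real b) (real N) = real m"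
  | "b ^ m < N" "frac (- log (real b) (real N)) = real m + 1 - log (real b) (real N)"
    "real m < log (real b) (real N)" "log (real b) (real N) < real m + 1"
    "real b powr (real m + 1 - log (real b) (real N)) = real b ^ Suc m / real N"
proof (cases "N = b ^ m")
  case True
  then have "log (real b) (real N) = real m" using b by (simp add: log_nat_power)
  moreover from this have "frac (- log (real b) (real N)) = 0"
    by simp
  ultimately show ?thesis using True that(1) by blast
next
  case False
  with m have less: "b ^ m < N" by simp
  have N: "N > 0" using less by simp
  have 1: "real m < log (real b) (real N)"
    using less b N by (simp add: less_log_iff powr_realpow flip: of_nat_power)
  have 2: "log (real b) (real N) < real m + 1"
  proof -
    have "real N < real b powr real (Suc m)"
      using m b by (subst powr_realpow) (auto simp flip: of_nat_power of_nat_mult)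
    then show ?thesis using b N by (simp add: log_less_iff add.commute)
  qed
  have "real b powr (real m + 1 - log (real b) (real N)) = real b powr real (Suc m) / real b powr log (real b) (real N)"
    by (simp add: powr_diff add.commute)
  also have "\<dots> = real b ^ Suc m / real N"
    using b N by (subst powr_realpow) auto
  finally have 3: "real b powr (real m + 1 - log (real b) (real N)) = real b ^ Suc m / real N" .
  have "frac (- log (real b) (real N)) = real m + 1 - log (real b) (real N)"
    using 1 2 by (subst frac_unique_iff) (auto intro: Ints_minus simp: algebra_simps)
  with less 1 2 3 show ?thesis using that(2) by blast
qed

text \<open>One formula serves both cases because \<open>- y + real b powr y / (real b - 1)\<close>
  has the same value at \<open>y = 0\<close> and \<open>y = 1\<close>. The form is chosen to match
  \<open>sum_frac_log\<close>.\<close>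

lemma integral_exp_dist_rotated_log:
  fixes b N m :: nat
  assumes b: "b \<ge> 2" and m: "b ^ m \<le> N" "N < b ^ Suc m"
  shows "real N * (\<integral>x. x \<partial>exp_dist_rotated b (frac (- log (real b) (real N)))) =
    real N * (log (real b) (real N) - real m) - real N / ln (real b) + real b ^ Suc m / (real b - 1)"
    (is "real N * ?I = ?R")
proof -
  have b1: "real b > 1" using b by simp
  have "?I = real b / (real b - 1) - 1 / ln (real b) - frac (- log (real b) (real N))
      + (real b powr frac (- log (real b) (real N)) - 1) / (real b - 1)"
    using b by (intro integral_exp_dist_rotated) (auto simp: frac_lt_1)
  moreover have "b / (b - 1) - c - y + (z - 1) / (b - 1) = 1 - c - y + z / (b - 1)"
    if "b > 1" for b c y z :: real
  proof -
    have "b / (b - 1) = 1 + 1 / (b - 1)" using that by (simp add: field_simps)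
    then show ?thesis by (simp add: diff_divide_distrib)
  qed
  ultimately have I: "?I = 1 - 1 / ln (real b) - frac (- log (real b) (real N))
      + real b powr frac (- log (real b) (real N)) / (real b - 1)"
    using b1 by simp
  show ?thesis
  proof (rule frac_neg_log_cases[OF assms])
    assume h: "N = b ^ m" "frac (- log (real b) (real N)) = 0" "log (real b) (real N) = real m"
    have "?I = 1 - 1 / ln (real b) + 1 / (real b - 1)"
      using I b1 unfolding h(2) by simp
    then show ?thesis using b1 by (simp only: h(3)) (simp add: h(1) field_simps)
  next
    assume "b ^ m < N" and h: "frac (- log (real b) (real N)) = real m + 1 - log (real b) (real N)"
      "real b powr (real m + 1 - log (real b) (real N)) = real b ^ Suc m / real N"
    then have "real N > 0" by simp
    moreover have "?I = 1 - 1 / ln (real b) - (real m + 1 - log (real b) (real N))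
        + real b ^ Suc m / real N / (real b - 1)"
      using I unfolding h .
    moreover have "real N * (u - v - w + z / real N / c) = real N * (u - w) - real N * v + z / c"
      if "real N > 0" for u v w z c
      using that by (simp add: right_diff_distrib distrib_left)
    ultimately show ?thesis by (simp only: h(1)) (simp add: algebra_simps)
  qed
qed

section \<open>Comparison of the distribution functions\<close>

text \<open>The right-hand side is the total length of the intervals from \<open>b powr k\<close> to
  \<open>b powr (k + t)\<close>, over all integers \<open>k \<le> m\<close>, cut at
  \<open>N\<close>. The first term sums the geometric series over \<open>k < m\<close>, negative
  \<open>k\<close> included; the rest is the interval for \<open>k = m\<close>. The proof resolves
  the two nested fractional parts of the distribution function.\<close>

lemma scaled_measure_exp_dist_rotated:
  fixes b N m :: nat
  assumes b: "b \<ge> 2" and m: "b ^ m \<le> N" "N < b ^ Suc m" and t: "t \<in> {0..<1}"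
  shows "real N * measure (exp_dist_rotated b (frac (- log (real b) (real N)))) {0..t} =
    (real b powr t - 1) * real b ^ m / (real b - 1)
      + min (real b ^ m * real b powr t) (real N) - real b ^ m"
proof -
  have b1: "real b > 1" using b by simp
  define p where "p = real b powr t"
  have p: "1 \<le> p" "p < real b"
    using ge_one_powr_ge_zero[of "real b" t] powr_less_mono[of t 1 "real b"] b1 t by (auto simp: p_def)
  define y where "y = frac (- log (real b) (real N))"
  define M where "M = measure (exp_dist_rotated b y) {0..t}"
  have y01: "y \<in> {0..<1}" by (simp add: y_def frac_lt_1)
  have M_frac: "M = frac ((real b powr frac (t + y) - real b powr y) / (real b - 1))"
    unfolding M_def using b y01 t by (intro measure_exp_dist_rotated) auto
  have bm: "real b ^ m > 0" using b1 by simp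
  have "real N * M = (p - 1) * real b ^ m / (real b - 1) + min (real b ^ m * p) (real N) - real b ^ m"
  proof (rule frac_neg_log_cases[OF b m])
    assume h: "N = b ^ m" "frac (- log (real b) (real N)) = 0"
    have "(p - 1) / (real b - 1) \<in> {0..<1}" using p b1 by simp
    then have "M = (p - 1) / (real b - 1)"
      using M_frac b1 t h(2) by (simp add: frac_eq[THEN iffD2] p_def y_def)
    moreover have "min (real b ^ m * p) (real b ^ m) = real b ^ m"
      using p b1 by (intro min_absorb2) simp
    ultimately show ?thesis by (simp add: h(1))
  next
    assume "b ^ m < N" and h: "frac (- log (real b) (real N)) = real m + 1 - log (real b) (real N)"
      "real m < log (real b) (real N)" "log (real b) (real N) < real m + 1"
    then have N0: "real N > 0" and N1: "real b ^ m < real N"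
      by (auto simp flip: of_nat_power)
    have N2: "real N < real b ^ Suc m" using m(2) by (simp flip: of_nat_power of_nat_mult)
    \<comment> \<open>\<open>x\<close> is the fractional part of the logarithm of \<open>N\<close>,
      so that \<open>y = 1 - x\<close>, and \<open>q = real b powr x\<close> is the ratio of
      \<open>N\<close> to \<open>b ^ m\<close>.\<close>
    define x where "x = log (real b) (real N) - real m"
    have x: "0 < x" "x < 1" and y: "y = 1 - x" using h by (auto simp: x_def y_def)
    define q where "q = real b powr x"
    have N_eq: "real N = real b ^ m * q"
      using b1 N0 unfolding x_def q_def by (simp add: powr_diff powr_realpow)
    have b_y: "real b powr y = real b / q"
      using b1 by (simp add: y powr_diff q_def)
    have q: "1 < q" "q < real b"
      using N1 N2 bm by (auto simp: N_eq)
    show ?thesis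
    \<comment> \<open>\<open>t < x\<close> means that the last interval ends before
      \<open>N\<close>. Then \<open>t + y\<close> does not wrap around and the outer argument lies
      in \<open>{0..<1}\<close>. Otherwise \<open>t + y\<close> wraps, the outer argument lies in
      \<open>{-1..<0}\<close>, and its fractional part adds 1.\<close>
    proof (cases "t < x")
      case True
      have "frac (t + y) = t + 1 - x"
        using True t x unfolding y by (auto simp: frac_unique_iff)
      then have e: "real b powr frac (t + y) = p * (real b / q)"
        using b1 by (simp add: powr_diff powr_add p_def q_def)
      have pq: "p < q" unfolding p_def q_def using b1 True by (intro powr_less_mono) auto
      have "(p * (c / q) - c / q) / (c - 1) \<in> {0..<1}" if "c > 1" "q < c" for c
      proof -
        have "(p - 1) * c \<le> (q - 1) * c"
          using pq that by (intro mult_right_mono) auto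
        also have "\<dots> < (c - 1) * q"
          using that by (simp add: algebra_simps)
        finally have "(p - 1) * c / ((c - 1) * q) \<in> {0..<1}"
          using p q that by (simp add: divide_less_eq)
        moreover have "(p * (c / q) - c / q) / (c - 1) = (p - 1) * c / ((c - 1) * q)"
          using q that by (simp add: divide_simps) (simp add: algebra_simps)
        ultimately show ?thesis by simp
      qed
      then have "M = (p * (real b / q) - real b / q) / (real b - 1)"
        using b1 q unfolding M_frac e b_y by (simp add: frac_eq[THEN iffD2])
      moreover have "min (real b ^ m * p) (real N) = real b ^ m * p"
        using pq bm by (intro min_absorb1) (simp add: N_eq)
      moreover have "r * q * ((p * (c / q) - c / q) / (c - 1)) = (p - 1) * r / (c - 1) + r * p - r"
        if "c > 1" for c r
        using that q by (simp add: divide_simps) (simp add: algebra_simps)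
      ultimately show ?thesis using b1 N_eq by simp
    next
      case False
      have "frac (t + y) = t - x"
        using False t x unfolding y by (auto simp: frac_unique_iff)
      then have e: "real b powr frac (t + y) = p / q"
        using b1 by (simp add: powr_diff p_def q_def)
      have pq: "q \<le> p" unfolding p_def q_def using b1 False by (intro powr_mono) auto
      have "(p / q - c / q) / (c - 1) + 1 \<in> {0..<1}" if "c > 1" "p < c" for c
      proof -
        have "1 * (c - 1) \<le> q * (c - 1)"
          using q that by (intro mult_right_mono) auto
        then have "c - p \<le> q * (c - 1)" using p by simp
        then have "(c - p) / (q * (c - 1)) \<in> {0<..1}"
          using q that by simp
        moreover have "(p / q - c / q) / (c - 1) = - ((c - p) / (q * (c - 1)))"
          using q that by (simp add: divide_simps)
        ultimately show ?thesis by simp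
      qed
      then have "(p / q - real b / q) / (real b - 1) + 1 \<in> {0..<1}"
        using b1 p by simp
      then have "M = (p / q - real b / q) / (real b - 1) + 1"
        unfolding M_frac e b_y by (subst frac_unique_iff) auto
      moreover have "min (real b ^ m * p) (real N) = real N"
        using pq bm by (intro min_absorb2) (simp add: N_eq)
      moreover have "r * q * ((p / q - c / q) / (c - 1) + 1) = (p - 1) * r / (c - 1) + r * q - r"
        if "c > 1" for c r
        using that q by (simp add: divide_simps) (simp add: algebra_simps)
      ultimately show ?thesis using b1 N_eq by simp
    qed
  qed
  then show ?thesis by (simp only: M_def y_def p_def)
qed

section \<open>Counting integers in the intervals\<close>

text \<open>The bounds place the logarithm of \<open>n\<close> between \<open>k\<close> and
  \<open>k + t < k + 1\<close>, which pins its floor to \<open>k\<close>.\<close>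

lemma frac_log_le:
  fixes b k n :: nat
  assumes b: "b \<ge> 2" and t: "t \<in> {0..<1}"
    and n: "b ^ k \<le> n" "real n \<le> real b ^ k * real b powr t"
  shows "frac (log (real b) (real n)) \<le> t"
proof -
  have b1: "real b > 1" using b by simp
  have "b ^ k > 0" using b by simp
  then have n0: "n > 0" using n(1) by linarith
  have "real n \<le> real b powr (real k + t)"
    using n(2) b1 by (simp add: powr_add powr_realpow)
  then have le: "log (real b) (real n) \<le> real k + t"
    using b1 n0 by (simp add: log_le_iff)
  have "real k \<le> log (real b) (real n)"
    using n(1) b1 n0 by (simp add: le_log_iff powr_realpow flip: of_nat_power)
  with le t have "\<lfloor>log (real b) (real n)\<rfloor> = int k" by (intro floor_unique) auto
  with le show ?thesis by (simp add: frac_def)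
qed

text \<open>An interval that starts at the integer \<open>b ^ k\<close> contains at least as many
  integers as its length, so rounding loses nothing. The sum over the disjoint intervals starts at
  \<open>k = 0\<close>, hence \<open>real b ^ m - 1\<close> in place of the
  \<open>real b ^ m\<close> of the exact mass.\<close>

lemma card_frac_log_le_ge:
  fixes b N m :: nat
  assumes b: "b \<ge> 2" and m: "b ^ m \<le> N" and t: "t \<in> {0..<1}"
  shows "(real b powr t - 1) * (real b ^ m - 1) / (real b - 1)
      + min (real b ^ m * real b powr t) (real N) - real b ^ m
    \<le> real (card {n \<in> {1..N}. frac (log (real b) (real n)) \<le> t})"
proof -
  have b1: "real b > 1" using b by simp
  have bt: "1 \<le> real b powr t" using b1 t by (intro ge_one_powr_ge_zero) auto
  have btb: "real b powr t < real b"
    using powr_less_mono[of t 1 "real b"] b1 t by simp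
  \<comment> \<open>\<open>x k\<close> is the right end of the \<open>k\<close>-th interval, cut at
    \<open>N\<close>; for \<open>k \<le> m\<close> the cut can matter only at \<open>k = m\<close>.
    \<open>B k\<close> collects the integers of that interval.\<close>
  define x where "x = (\<lambda>k. min (real b ^ k * real b powr t) (real N))"
  define B where "B = (\<lambda>k. {b ^ k..nat \<lfloor>x k\<rfloor>})"
  have mem: "b ^ k \<le> n \<and> real n \<le> x k" if "n \<in> B k" for n k
  proof -
    have "n \<le> nat \<lfloor>x k\<rfloor>" "b ^ k \<le> n" using that by (auto simp: B_def)
    moreover have "b ^ k > 0" using b by simp
    ultimately have "int n \<le> \<lfloor>x k\<rfloor>" by linarith
    then show ?thesis using \<open>b ^ k \<le> n\<close> by (simp add: le_floor_iff)
  qed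
  \<comment> \<open>The case split marks where the natural subtraction in the cardinality is exact;
    in the other case the left-hand side is not positive.\<close>
  have card_B: "x k - real b ^ k \<le> real (card (B k))" for k
  proof (cases "b ^ k \<le> nat \<lfloor>x k\<rfloor> + 1")
    case True
    have "real (card (B k)) = real (nat \<lfloor>x k\<rfloor>) + 1 - real b ^ k"
      using True by (simp add: B_def of_nat_diff)
    then show ?thesis by linarith
  next
    case False
    then have "real (nat \<lfloor>x k\<rfloor>) + 1 \<le> real (b ^ k)" by linarith
    then have "x k \<le> real b ^ k" by simp linarith
    then show ?thesis by (simp add: order_trans[of _ 0])
  qed
  have disj: "disjoint_family_on B {..m}"
  proof -
    have False if "i < j" "n \<in> B i" "n \<in> B j" for i j n
    proof -
      have "real b ^ j \<le> real n" using mem[OF that(3)] by (simp flip: of_nat_power)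
      also have "real n \<le> real b ^ i * real b powr t" using mem[OF that(2)] by (simp add: x_def)
      also have "\<dots> < real b ^ Suc i" using btb b1 by simp
      also have "\<dots> \<le> real b ^ j" using that(1) b1 by (intro power_increasing) auto
      finally show False by simp
    qed
    then show ?thesis unfolding disjoint_family_on_def by (metis disjoint_iff nat_neq_iff)
  qed
  have "(real b powr t - 1) * (real b ^ m - 1) / (real b - 1)
      + min (real b ^ m * real b powr t) (real N) - real b ^ m
    = (\<Sum>k<m. real b ^ k * (real b powr t - 1)) + (x m - real b ^ m)"
  proof -
    have "(\<Sum>k<m. real b ^ k) = (real b ^ m - 1) / (real b - 1)"
      using sum_power_mult_pred[of 0 m "real b"] b1
      by (simp add: eq_divide_eq atLeast0LessThan)
    then show ?thesis by (simp add: x_def mult.commute flip: sum_distrib_right)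
  qed
  also have "(\<Sum>k<m. real b ^ k * (real b powr t - 1)) = (\<Sum>k<m. x k - real b ^ k)"
  proof (rule sum.cong)
    fix k assume "k \<in> {..<m}"
    then have "b ^ Suc k \<le> b ^ m" using b by (intro power_increasing) auto
    then have "real b ^ Suc k \<le> real N" using m by (simp flip: of_nat_power of_nat_mult)
    moreover have "real b ^ k * real b powr t \<le> real b ^ Suc k" using btb b1 by simp
    ultimately show "real b ^ k * (real b powr t - 1) = x k - real b ^ k"
      by (simp add: x_def algebra_simps)
  qed simp
  also have "\<dots> + (x m - real b ^ m) = (\<Sum>k\<le>m. x k - real b ^ k)"
    by (simp add: lessThan_Suc_atMost[symmetric])
  also have "\<dots> \<le> (\<Sum>k\<le>m. real (card (B k)))" by (intro sum_mono card_B)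
  also have "\<dots> = real (card (\<Union>k\<le>m. B k))"
    using disj by (subst card_UN_disjoint) (auto simp: disjoint_family_on_def B_def)
  also have "\<dots> \<le> real (card {n \<in> {1..N}. frac (log (real b) (real n)) \<le> t})"
  proof (intro of_nat_mono card_mono)
    show "(\<Union>k\<le>m. B k) \<subseteq> {n \<in> {1..N}. frac (log (real b) (real n)) \<le> t}"
    proof safe
      fix k n assume n: "n \<in> B k"
      show "frac (log (real b) (real n)) \<le> t"
        using mem[OF n] by (intro frac_log_le[OF b t, of k]) (auto simp: x_def)
      have "0 < b ^ k" using b by simp
      also have "b ^ k \<le> n" using mem[OF n] by simp
      finally show "n \<in> {1..N}" using mem[OF n] by (auto simp: x_def)
    qed
  qed auto
  finally show ?thesis .
qed

text \<open>After scaling by \<open>N\<close>, the exact mass exceeds the counting bound by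
  \<open>(real b powr t - 1) / (real b - 1)\<close>. This is the total length of the intervals with
  negative \<open>k\<close>, which contain no integers, and it is at most 1.\<close>

lemma measure_exp_dist_rotated_le_log_empirical:
  fixes b N :: nat
  assumes b: "b \<ge> 2" and m: "b ^ m \<le> N" "N < b ^ Suc m" and t: "t \<in> {0..<1}"
  shows "measure (exp_dist_rotated b (frac (- log (real b) (real N)))) {0..t}
    \<le> measure (log_empirical b N) {0..t} + 1 / real N"
proof -
  have b1: "real b > 1" using b by simp
  have "b ^ m > 0" using b by simp
  then have N: "N > 0" using m(1) by linarith
  have "real N * measure (exp_dist_rotated b (frac (- log (real b) (real N)))) {0..t}
      = (real b powr t - 1) * (real b ^ m - 1) / (real b - 1)
        + min (real b ^ m * real b powr t) (real N) - real b ^ m + (real b powr t - 1) / (real b - 1)"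
  proof -
    have "(p - 1) * q / c = (p - 1) * (q - 1) / c + (p - 1) / c" for p q c :: real
      by (simp add: add_divide_distrib[symmetric] algebra_simps)
    from this[of "real b powr t" "real b ^ m" "real b - 1"]
    show ?thesis unfolding scaled_measure_exp_dist_rotated[OF assms] by linarith
  qed
  also have "\<dots> \<le> real (card {n \<in> {1..N}. frac (log (real b) (real n)) \<le> t}) + 1"
  proof (intro add_mono card_frac_log_le_ge b m t)
    show "(real b powr t - 1) / (real b - 1) \<le> 1"
      using powr_less_mono[of t 1 "real b"] b1 t by simp
  qed
  also have "real (card {n \<in> {1..N}. frac (log (real b) (real n)) \<le> t}) = real N * measure (log_empirical b N) {0..t}"
    using N t by (subst measure_log_empirical) (auto simp: sets_unit_borel)
  finally show ?thesis using N by (simp add: field_simps)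
qed

section \<open>Asymptotics\<close>

text \<open>The midpoint and trapezoid bounds for the integral of \<open>1 / x\<close> over
  \<open>{n..n + 1}\<close> show that the error \<open>d\<close> decreases in each step by at most a
  telescoping amount. It starts at \<open>d 1 = 1\<close>.\<close>

lemma ln_fact_stirling:
  assumes "n \<ge> 1"
  shows "\<bar>ln (fact n) - ((real n + 1 / 2) * ln (real n) - real n)\<bar> \<le> 1"
proof -
  define d where "d = (\<lambda>n::nat. ln (fact n) - ((real n + 1 / 2) * ln (real n) - real n))"
  have decrement: "d n - d (Suc n) \<in> {0..1 / (4 * real n) - 1 / (4 * real (Suc n))}" if n: "n \<ge> 1" for n
  proof -
    let ?l = "ln (real n + 1) - ln (real n)"
    have n0: "real n > 0" using n by simp
    have d: "d n - d (Suc n) = (real n + 1 / 2) * ?l - 1"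
    proof -
      have "ln (fact (Suc n)) = ln (real n + 1) + ln (fact n)"
        by (simp add: ln_mult add.commute)
      then show ?thesis by (simp only: d_def) (simp add: algebra_simps)
    qed
    have "2 / (2 * real n + 1) \<le> ?l"
      using ln_inverse_approx_ge[of "real n" "real n + 1"] n0 by simp
    from mult_left_mono[OF this, of "real n + 1 / 2"]
    have lo: "1 \<le> (real n + 1 / 2) * ?l" using n0 by (simp add: field_simps)
    have "?l \<le> (inverse (real n) + inverse (real n + 1)) / 2"
      using ln_inverse_approx_le[of "real n" 1] n0 by simp
    from mult_left_mono[OF this, of "real n + 1 / 2"]
    have "(real n + 1 / 2) * ?l \<le> (real n + 1 / 2) * ((inverse (real n) + inverse (real n + 1)) / 2)"
      using n0 by simp
    also have "\<dots> = 1 + (1 / (4 * real n) - 1 / (4 * real (Suc n)))"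
      using n0 by (simp add: divide_simps) (simp add: algebra_simps)
    finally show ?thesis using d lo
      by (simp only: atLeastAtMost_iff) linarith
  qed
  \<comment> \<open>The lower end carries \<open>1 / (4 * real n)\<close> so that the decrements
    telescope in the induction; at \<open>n = 1\<close> both ends equal 1.\<close>
  have "d n \<in> {3 / 4 + 1 / (4 * real n)..1}"
    using assms
  proof (induction n rule: dec_induct)
    case base
    then show ?case by (simp add: d_def)
  next
    case (step n)
    then show ?case using decrement[OF step.hyps(1)]
      unfolding atLeastAtMost_iff by linarith
  qed
  moreover have "1 / (4 * real n) \<ge> 0" by simp
  ultimately show ?thesis unfolding d_def atLeastAtMost_iff by linarith
qed

section \<open>The error bound and the limit\<close>

text \<open>The constant 5 covers \<open>real b / (real b - 1) \<le> 2\<close>, a fractional part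
  below 1, and the 2 lost between the lower and upper bounds by the means. The term
  \<open>1 / ln (real b)\<close> is the Stirling error.\<close>

lemma kantorovich_log_empirical_bound:
  fixes b N :: nat
  assumes b: "b \<ge> 2" and N: "N \<ge> 1"
  shows "\<bar>real N * kantorovich (log_empirical b N) (exp_dist_rotated b (frac (- log (real b) (real N))))
    - ln (real N) / (2 * ln (real b))\<bar> \<le> 5 + 1 / ln (real b)"
    (is "\<bar>real N * ?K - _\<bar> \<le> _")
proof -
  have b1: "real b > 1" and lnb: "ln (real b) > 0" using b by auto
  define m where "m = nat \<lfloor>log (real b) (real N)\<rfloor>"
  have log0: "log (real b) (real N) \<ge> 0" using b1 N by (simp add: zero_le_log_cancel_iff)
  then have m_floor: "int m = \<lfloor>log (real b) (real N)\<rfloor>" by (simp add: m_def)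
  have m: "b ^ m \<le> N" "N < b ^ Suc m"
    using power_le_iff_le_floor_log[of b N m] power_le_iff_le_floor_log[of b N "Suc m"] b N
    by (auto simp: m_floor not_le[symmetric])
  have m_log: "real m = log (real b) (real N) - frac (log (real b) (real N))"
  proof -
    have "real m = real_of_int (int m)" by simp
    then show ?thesis by (simp only: m_floor frac_def)
  qed
  let ?\<mu> = "log_empirical b N" and ?\<nu> = "exp_dist_rotated b (frac (- log (real b) (real N)))"
  let ?D = "(\<integral>x. x \<partial>?\<nu>) - (\<integral>x. x \<partial>?\<mu>)"
  note \<mu> = prob_space_log_empirical[OF N, of b] and \<nu> = prob_space_exp_dist_rotated[OF b]
  have lower: "?D \<le> ?K"
    by (intro kantorovich_ge_mean_diff \<mu> \<nu>) auto
  have upper: "?K \<le> ?D + 2 * (1 / real N)"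
    using measure_exp_dist_rotated_le_log_empirical[OF b m]
    by (intro kantorovich_le_mean_diff \<mu> \<nu>) auto
  define e where "e = ln (fact N) - ((real N + 1 / 2) * ln (real N) - real N)"
  have e: "\<bar>e\<bar> \<le> 1" unfolding e_def using N by (rule ln_fact_stirling)
  have "real N * ?D = real N * (\<integral>x. x \<partial>?\<nu>) - (\<Sum>n = 1..N. frac (log (real b) (real n)))"
    using N by (simp add: integral_log_empirical right_diff_distrib)
  \<comment> \<open>The terms \<open>real m * real N\<close> and
    \<open>real b ^ Suc m / (real b - 1)\<close> of the two closed forms cancel.\<close>
  also have "\<dots> = real N * log (real b) (real N) - real N / ln (real b) - ln (fact N) / ln (real b)
      + real m + real b / (real b - 1)"
    unfolding integral_exp_dist_rotated_log[OF b m] sum_frac_log[OF b m]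
    by (simp add: algebra_simps diff_divide_distrib)
  \<comment> \<open>The terms of order \<open>N * ln N\<close> and \<open>N\<close> cancel.
    \<open>real m\<close> contributes one logarithm of \<open>N\<close> up to its fractional part,
    and the \<open>1 / 2\<close> in Stirling's formula removes half of it.\<close>
  also have "\<dots> = ln (real N) / (2 * ln (real b)) + (real b / (real b - 1)
      - frac (log (real b) (real N)) - e / ln (real b))"
  proof -
    have "ln (fact N) = (real N + 1 / 2) * ln (real N) - real N + e" by (simp add: e_def)
    then show ?thesis
      using lnb by (simp add: m_log log_def) (simp add: field_simps)
  qed
  finally have D: "real N * ?D - ln (real N) / (2 * ln (real b)) =
      real b / (real b - 1) - frac (log (real b) (real N)) - e / ln (real b)" by simp
  have 1: "\<bar>e / ln (real b)\<bar> \<le> 1 / ln (real b)"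
    using e lnb by (simp add: divide_right_mono)
  have 2: "0 \<le> real b / (real b - 1)" "real b / (real b - 1) \<le> 2"
    using b by (auto simp: field_simps)
  have 3: "0 \<le> frac (log (real b) (real N))" "frac (log (real b) (real N)) < 1"
    by (auto simp: frac_lt_1)
  have "real N * ?D \<le> real N * ?K" "real N * ?K \<le> real N * ?D + 2"
    using mult_left_mono[OF lower, of "real N"] mult_left_mono[OF upper, of "real N"] N
    by (auto simp: algebra_simps)
  with D 1 2 3 show ?thesis by linarith
qed

theorem theorem3:
  fixes b :: nat
  assumes "b \<ge> 2"
  shows "(\<lambda>N::nat. real N / ln (real N) *
           kantorovich (log_empirical b N) (exp_dist_rotated b (frac (- log (real b) (real N)))))
         \<longlonglongrightarrow> 1 / (2 * ln (real b))"
proof -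
  let ?K = "\<lambda>N. kantorovich (log_empirical b N) (exp_dist_rotated b (frac (- log (real b) (real N))))"
  have ln_inf: "filterlim (\<lambda>N. ln (real N)) at_top sequentially"
    by (rule filterlim_compose[OF ln_at_top filterlim_real_sequentially])
  have "(\<lambda>N. (5 + 1 / ln (real b)) / ln (real N)) \<longlonglongrightarrow> 0"
    using ln_inf by (intro tendsto_divide_0[OF tendsto_const] filterlim_at_top_imp_at_infinity)
  \<comment> \<open>The error bound, uniform in \<open>N\<close>, is divided by
    \<open>ln (real N)\<close>, which is positive from \<open>N = 2\<close> on.\<close>
  moreover have "\<forall>\<^sub>F N in sequentially. norm (real N / ln (real N) * ?K N - 1 / (2 * ln (real b)))
      \<le> (5 + 1 / ln (real b)) / ln (real N)"
    using eventually_ge_at_top[of 2]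
  proof eventually_elim
    case (elim N)
    then have l: "ln (real N) > 0" by simp
    have "real N / ln (real N) * ?K N - 1 / (2 * ln (real b))
        = (real N * ?K N - ln (real N) / (2 * ln (real b))) / ln (real N)"
      using l by (simp add: diff_divide_distrib)
    then show ?case
      using kantorovich_log_empirical_bound[OF assms, of N] elim l
      by (simp add: divide_right_mono)
  qed
  ultimately have "(\<lambda>N. real N / ln (real N) * ?K N - 1 / (2 * ln (real b))) \<longlonglongrightarrow> 0"
    by (rule Lim_null_comparison[rotated])
  then show ?thesis by (rule LIM_zero_cancel)
qed

end
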